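(* Let $\Delta\subset\mathbb R^2$ be the triangular region with vertices $P_1,P_2,P_3$. A point $m\in\mathbb R^2$ is the geometric median of $\Delta$ if and only if $$\frac{\Sigma_{P_1P_2}(m)}{|P_2-P_1|}=\frac{\Sigma_{P_2P_3}(m)}{|P_3-P_2|}=\frac{\Sigma_{P_3P_1}(m)}{|P_1-P_3|},$$ that is, the three average distances from $m$ to the three sides of the boundary triangle are equal to each other.
   Context: $|\cdot|$ is the Euclidean norm on $\mathbb R^2$, so $|P-X|$ is the Euclidean distance between the points $P$ and $X$. A triangular region is the (two-dimensional) region bounded by a triangle with non-collinear vertices. For a region $\Omega\subset\mathbb R^2$ put $\Sigma_\Omega(X)=\int_{P\in\Omega}|P-X|\,dP$ (integral with respect to area), $X\in\mathbb R^2$. The geometric median of $\Omega$ is the point $m=\mathop{\mathrm{arg\,min}}_{X\in\mathbb R^2}\Sigma_\Omega(X)$. For points $A,B\in\mathbb R^2$, $\Sigma_{AB}(X)=\int_{P\in AB}|P-X|\,dP$ is the integral over the line segment $AB$ with respect to arc length, so $\Sigma_{AB}(X)/|B-A|$ is the average distance from $X$ to the points of the segment $AB$. *)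

theory Defs
  imports "HOL-Analysis.Analysis"
begin

definition dist_integral :: "(real^2) set \<Rightarrow> real^2 \<Rightarrow> real" where
  "dist_integral \<Omega> X = (LINT P:\<Omega>|lebesgue. norm (P - X))"

(* "The" geometric median: m is a minimiser over the whole plane, and the only one. *)
definition is_geometric_median :: "(real^2) set \<Rightarrow> real^2 \<Rightarrow> bool" where
  "is_geometric_median \<Omega> m \<longleftrightarrow> {X. is_arg_min (dist_integral \<Omega>) (\<lambda>_. True) X} = {m}"

(* Line integral of f with respect to arc length, ds = |g'(t)| dt. *)
definition arclength_integral :: "(real \<Rightarrow> real^2) \<Rightarrow> (real^2 \<Rightarrow> real) \<Rightarrow> real" where
  "arclength_integral g f =
     (LINT t:{0..1}|lebesgue. f (g t) * norm (vector_derivative g (at t within {0..1})))"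

definition segment_dist_integral :: "real^2 \<Rightarrow> real^2 \<Rightarrow> real^2 \<Rightarrow> real" where
  "segment_dist_integral A B X = arclength_integral (linepath A B) (\<lambda>P. norm (P - X))"

end

(*
Write P = A + s(B - A) + t(C - A) over the standard triangle. Moving X by h(B - A) shifts s by -h,
so only the boundary s = 0 (side AC) and s = 1 - t (side BC) contributes to first order: the
derivative of the distance integral in the direction B - A is a positive multiple of the mean
distance to AC minus the mean distance to BC. Hence the mean distances coincide exactly at the
critical points. The distance integral is strictly convex, so a critical point is the unique
minimiser. As the partial derivatives are Lipschitz in X, all estimates can be made with explicit
quadratic error terms, without differentiating under the integral sign.
*)
theory Submission
  imports Defs
begin

section \<open>Integration over a triangle in affine coordinates\<close>

lemma absolutely_integrable_continuous_compact:
  fixes f :: "'a::euclidean_space \<Rightarrow> 'b::euclidean_space"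
  assumes "continuous_on T f" "compact T"
  shows "f absolutely_integrable_on T"
  using borel_integrable_compact[OF assms(2,1)] by (simp add: set_integrable_def integrable_completion)

text \<open>Open boxes pull back to open boxes of the same area, and \<open>lborel\<close> is
  determined by its values on boxes. This carries Fubini's theorem from pairs of reals over to
  \<open>real^2\<close>.\<close>

lemma distr_lborel_pair_vector:
  "distr (lborel :: (real \<times> real) measure) borel (\<lambda>p. vector [fst p, snd p]) = (lborel :: (real^2) measure)"
    (is "distr _ _ ?g = _")
proof (rule lborel_eqI[symmetric])
  have cont: "continuous_on UNIV (\<lambda>p. vector [fst p, snd p] :: real^2)"
    by (subst continuous_on_componentwise)
       (auto simp: Basis_vec_def inner_axis forall_2 intro!: continuous_intros)
  then have meas: "?g \<in> borel_measurable lborel"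
    by (simp add: borel_measurable_continuous_onI)
  fix l u :: "real^2"
  assume lu: "\<And>b. b \<in> Basis \<Longrightarrow> l \<bullet> b \<le> u \<bullet> b"
  have le: "l $ i \<le> u $ i" for i
    using lu[of "axis i 1"] by (auto simp: inner_axis axis_in_Basis_iff)
  have vim: "?g -` box l u = box (l $ 1, l $ 2) (u $ 1, u $ 2)"
  proof -
    have "box (a, b) (c, d) = {p. a < fst p \<and> fst p < c \<and> b < snd p \<and> snd p < d}" for a b c d :: real
      by (auto simp: box_def Basis_prod_def)
    then show ?thesis by (auto simp: mem_box_cart forall_2)
  qed
  have "emeasure (distr lborel borel ?g) (box l u) = emeasure lborel (box (l $ 1, l $ 2) (u $ 1, u $ 2))"
    using meas by (simp add: emeasure_distr vim)
  also have "\<dots> = (u $ 1 - l $ 1) * (u $ 2 - l $ 2)"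
    using le by (subst emeasure_lborel_box) (auto simp: Basis_prod_def prod.union_disjoint)
  also have "\<dots> = (\<Prod>b\<in>Basis. (u - l) \<bullet> b)"
    by (simp add: Basis_vec_def cart_eq_inner_axis UNIV_2 axis_eq_axis inner_diff_left mult.commute)
  finally show "emeasure (distr lborel borel ?g) (box l u) = (\<Prod>b\<in>Basis. (u - l) \<bullet> b)" .
qed simp

lemma integral_affine_image_cart:
  fixes L :: "real^2 \<Rightarrow> real^2" and f :: "real^2 \<Rightarrow> real"
  assumes L: "linear L" "inj L" and S: "compact S" and f: "continuous_on UNIV f"
  shows "integral ((\<lambda>x. p + L x) ` S) f = \<bar>det (matrix L)\<bar> * integral S (\<lambda>x. f (p + L x))"
proof -
  let ?g = "\<lambda>x. p + L x"
  \<comment> \<open>The change of variables formula is applied to an integrand with values in a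
    Cartesian space, so \<open>f\<close> is wrapped as a \<open>real^1\<close>-valued function and
    its only component is read off afterwards.\<close>
  define F where "F = (\<lambda>x. vec (f x) :: real^1)"
  have contL: "continuous_on U L" for U
    using L(1) by (simp add: linear_continuous_on linear_conv_bounded_linear)
  have contv: "continuous_on U (\<lambda>x. vec (h x) :: real^1)" if "continuous_on U h" for U and h :: "real^2 \<Rightarrow> real"
    using that unfolding vec_def by (intro continuous_on_vec_lambda)
  have cT: "compact (?g ` S)"
    by (intro compact_continuous_image S continuous_intros contL)
  have F: "F absolutely_integrable_on ?g ` S"
    using f unfolding F_def by (intro absolutely_integrable_continuous_compact cT contv) (auto intro: continuous_on_subset)
  have "integral (?g ` S) F = integral S (\<lambda>x. \<bar>det (matrix L)\<bar> *\<^sub>R F (?g x))"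
  proof (rule integral_change_of_variables)
    show "S \<in> sets lebesgue" using S by (simp add: borel_compact)
    show "(?g has_derivative L) (at x within S)" for x
      by (auto intro!: derivative_eq_intros linear_imp_has_derivative L)
    show "inj_on ?g S" using L(2) by (auto simp: inj_on_def)
  qed (use F in auto)
  then have "integral (?g ` S) F $ 1 = integral S (\<lambda>x. \<bar>det (matrix L)\<bar> *\<^sub>R F (?g x)) $ 1" by simp
  moreover have "F integrable_on ?g ` S" using F set_lebesgue_integral_eq_integral(1) by blast
  then have "integral (?g ` S) F $ 1 = integral (?g ` S) f"
    by (subst integral_component_eq_cart[symmetric]) (auto simp: F_def)
  moreover have "continuous_on S (\<lambda>x. F (?g x))"
    unfolding F_def by (intro contv continuous_on_compose2[OF f] continuous_intros contL) auto
  then have "(\<lambda>x. \<bar>det (matrix L)\<bar> *\<^sub>R F (?g x)) integrable_on S"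
    by (intro set_lebesgue_integral_eq_integral(1) absolutely_integrable_continuous_compact S continuous_intros)
  then have "integral S (\<lambda>x. \<bar>det (matrix L)\<bar> *\<^sub>R F (?g x)) $ 1 = integral S (\<lambda>x. \<bar>det (matrix L)\<bar> * f (?g x))"
    by (subst integral_component_eq_cart[symmetric]) (auto simp: F_def)
  ultimately show ?thesis by simp
qed

lemma compact_standard_triangle:
  "compact {x::real^2. 0 \<le> x $ 1 \<and> 0 \<le> x $ 2 \<and> x $ 1 + x $ 2 \<le> 1}" (is "compact ?V")
proof -
  have "closed ?V"
    by (simp add: closed_Collect_conj closed_Collect_le continuous_on_add continuous_on_component)
  moreover have "?V \<subseteq> cbox 0 1" by (auto simp: mem_box_cart forall_2)
  ultimately show ?thesis by (simp add: compact_eq_bounded_closed bounded_subset[OF bounded_cbox])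
qed

text \<open>Fubini for \<open>h\<close> times the indicator of the triangle. Integrability of the
  inner integral is recorded too, since the outer integrals are later subtracted from one
  another.\<close>

lemma
  fixes h :: "real \<times> real \<Rightarrow> real"
  assumes h: "continuous_on UNIV h"
  shows integrable_standard_triangle:
     "(\<lambda>t. integral {0..1-t} (\<lambda>s. h (s, t))) integrable_on {0..1}"
   and integral_standard_triangle:
     "integral {x::real^2. 0 \<le> x $ 1 \<and> 0 \<le> x $ 2 \<and> x $ 1 + x $ 2 \<le> 1} (\<lambda>x. h (x $ 1, x $ 2))
      = integral {0..1} (\<lambda>t. integral {0..1-t} (\<lambda>s. h (s, t)))"
proof -
  let ?V = "{x::real^2. 0 \<le> x $ 1 \<and> 0 \<le> x $ 2 \<and> x $ 1 + x $ 2 \<le> 1}"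
  let ?T = "{p::real\<times>real. 0 \<le> fst p \<and> 0 \<le> snd p \<and> fst p + snd p \<le> 1}"
  let ?g = "\<lambda>p. vector [fst p, snd p] :: real^2"
  let ?I = "\<lambda>t. integral {0..1-t} (\<lambda>s. h (s, t))"
  let ?H = "\<lambda>p. indicator ?T p *\<^sub>R h p"
  have cT: "compact ?T"
  proof -
    have "closed ?T"
      by (intro closed_Collect_conj closed_Collect_le continuous_intros)
    moreover have "?T \<subseteq> cbox (0,0) (1,1)" by (auto simp: cbox_Pair_eq)
    ultimately show ?thesis by (simp add: compact_eq_bounded_closed bounded_subset[OF bounded_cbox])
  qed
  have hT: "integrable lborel ?H"
    by (rule borel_integrable_compact[OF cT continuous_on_subset[OF h]]) auto
  \<comment> \<open>Fubini integrates the second component innermost. Swapping the components makes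
    \<open>s\<close> the inner variable, the one on which a shift of the base point along
    \<open>B - A\<close> acts.\<close>
  then have hT': "integrable (lborel \<Otimes>\<^sub>M lborel) (\<lambda>p. ?H (snd p, fst p))"
    using lborel_pair.integrable_product_swap[of ?H] by (simp add: lborel_prod case_prod_beta')
  have cont: "continuous_on UNIV ?g"
    by (subst continuous_on_componentwise)
       (auto simp: Basis_vec_def inner_axis forall_2 intro!: continuous_intros)
  then have meas: "?g \<in> borel_measurable lborel"
    by (simp add: borel_measurable_continuous_onI)
  have hV: "integrable lborel (\<lambda>x::real^2. indicator ?V x *\<^sub>R h (x $ 1, x $ 2))"
    by (rule borel_integrable_compact[OF compact_standard_triangle])
       (auto intro!: continuous_intros continuous_on_compose2[OF h])
  have "integral ?V (\<lambda>x. h (x $ 1, x $ 2)) = (LINT x|lborel. indicator ?V x *\<^sub>R h (x $ 1, x $ 2))"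
    using set_borel_integral_eq_integral(2)[of ?V "\<lambda>x. h (x $ 1, x $ 2)"] hV
    by (simp add: set_integrable_def set_lebesgue_integral_def)
  also have "\<dots> = (LINT p|lborel. ?H p)"
    using hV meas
    by (subst distr_lborel_pair_vector[symmetric], subst integral_distr)
       (auto simp: indicator_def intro: Bochner_Integration.integral_cong)
  also have "\<dots> = integral\<^sup>L (lborel \<Otimes>\<^sub>M lborel) (\<lambda>p. ?H (snd p, fst p))"
    using lborel_pair.integral_product_swap[of ?H] hT
    by (simp add: lborel_prod case_prod_beta')
  also have "\<dots> = (LINT t|lborel. LINT s|lborel. ?H (s, t))"
    using lborel_pair.integral_fst'[OF hT'] by simp
  finally have eq1: "integral ?V (\<lambda>x. h (x $ 1, x $ 2)) = (LINT t|lborel. LINT s|lborel. ?H (s, t))" .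
  have int: "integrable lborel (\<lambda>t. LINT s|lborel. ?H (s, t))"
    using lborel_pair.integrable_fst'[OF hT'] by simp
  \<comment> \<open>For \<open>t\<close> in the unit interval the slice of the triangle is
    \<open>{0..1-t}\<close>; for all other \<open>t\<close> it is empty, which the outer indicator
    accounts for.\<close>
  have inner: "(LINT s|lborel. ?H (s, t)) = indicator {0..1} t *\<^sub>R ?I t" for t
  proof (cases "t \<in> {0..1}")
    case True
    have "set_integrable lborel {0..1-t} (\<lambda>s. h (s, t))"
      unfolding set_integrable_def
      by (intro borel_integrable_compact) (auto intro!: continuous_intros continuous_on_compose2[OF h])
    then have "(LINT s:{0..1-t}|lborel. h (s, t)) = ?I t"
      by (rule set_borel_integral_eq_integral)
    moreover have "(LINT s|lborel. ?H (s, t)) = (LINT s:{0..1-t}|lborel. h (s, t))"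
      using True unfolding set_lebesgue_integral_def
      by (intro Bochner_Integration.integral_cong) (auto simp: indicator_def)
    ultimately show ?thesis using True by simp
  next
    case False
    then have "(\<lambda>s. ?H (s, t)) = (\<lambda>_. 0)" by (auto simp: indicator_def)
    then have "(LINT s|lborel. ?H (s, t)) = 0" by (simp only: Bochner_Integration.integral_zero)
    then show ?thesis using False by simp
  qed
  have si: "set_integrable lborel {0..1} ?I"
    using int unfolding inner set_integrable_def .
  show "?I integrable_on {0..1}" by (rule set_borel_integral_eq_integral(1)[OF si])
  show "integral ?V (\<lambda>x. h (x $ 1, x $ 2)) = integral {0..1} ?I"
    using eq1 set_borel_integral_eq_integral(2)[OF si] unfolding inner set_lebesgue_integral_def by simp
qed

lemma linear_triangle_coordinates:
  fixes A B C :: "real^2"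
  shows "linear (\<lambda>x::real^2. x $ 1 *\<^sub>R (B - A) + x $ 2 *\<^sub>R (C - A))"
  by (rule linearI) (auto simp: algebra_simps)

text \<open>A nonzero kernel vector has a nonzero coordinate; dividing by it makes one edge vector a
  multiple of the other, so the vertices would be collinear.\<close>

lemma inj_triangle_coordinates:
  fixes A B C :: "real^2"
  assumes nc: "\<not> collinear {A, B, C}"
  shows "inj (\<lambda>x::real^2. x $ 1 *\<^sub>R (B - A) + x $ 2 *\<^sub>R (C - A))"
proof (subst linear_injective_0[OF linear_triangle_coordinates], safe)
  fix x :: "real^2" assume eq: "x $ 1 *\<^sub>R (B - A) + x $ 2 *\<^sub>R (C - A) = 0"
  have *: "collinear {A, A + u, A + v}" if "p *\<^sub>R u + q *\<^sub>R v = 0" "p \<noteq> 0"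
    for u v :: "real^2" and p q
  proof -
    have "u = (1 / p) *\<^sub>R (p *\<^sub>R u)" using \<open>p \<noteq> 0\<close> by simp
    also have "p *\<^sub>R u = - (q *\<^sub>R v)" using that(1) by (simp add: eq_neg_iff_add_eq_0)
    finally have "u = (- q / p) *\<^sub>R v" by simp
    then have "collinear {0, v, u}" unfolding collinear_lemma by blast
    then show ?thesis
      using collinear_3[of "A + u" A "A + v"] by (simp add: insert_commute)
  qed
  have "x $ 1 = 0 \<and> x $ 2 = 0"
    using *[of "x $ 1" "B - A" "x $ 2" "C - A"] *[of "x $ 2" "C - A" "x $ 1" "B - A"] eq nc
    by (auto simp: insert_commute add.commute)
  then show "x = 0" by (simp add: vec_eq_iff forall_2)
qed

text \<open>\<open>D\<close> is the absolute Jacobian determinant of the affine coordinates, twice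
  the area of the triangle. Later arguments rely only on its being positive and the same for every
  integrand.\<close>

lemma integral_triangle:
  fixes A B C :: "real^2"
  assumes nc: "\<not> collinear {A, B, C}"
  obtains D where "D > 0"
    "\<And>f :: real^2 \<Rightarrow> real. continuous_on UNIV f \<Longrightarrow> integral (convex hull {A, B, C}) f =
      D * integral {0..1} (\<lambda>t. integral {0..1-t} (\<lambda>s. f (A + s *\<^sub>R (B - A) + t *\<^sub>R (C - A))))"
proof
  let ?V = "{x::real^2. 0 \<le> x $ 1 \<and> 0 \<le> x $ 2 \<and> x $ 1 + x $ 2 \<le> 1}"
  define L where "L = (\<lambda>x::real^2. x $ 1 *\<^sub>R (B - A) + x $ 2 *\<^sub>R (C - A))"
  have lin: "linear L"
    unfolding L_def by (rule linear_triangle_coordinates)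
  have inj: "inj L"
    unfolding L_def using nc by (rule inj_triangle_coordinates)
  show "\<bar>det (matrix L)\<bar> > 0"
    using inj lin det_nz_iff_inj by fastforce
  fix f :: "real^2 \<Rightarrow> real" assume f: "continuous_on UNIV f"
  have "convex hull {A, B, C} = (\<lambda>x. A + L x) ` ?V"
  proof -
    have "A + u *\<^sub>R (B - A) + v *\<^sub>R (C - A) \<in> (\<lambda>x. A + L x) ` ?V" if "0 \<le> u" "0 \<le> v" "u + v \<le> 1" for u v
      using that by (intro image_eqI[of _ _ "vector [u, v]"]) (auto simp: L_def)
    then show ?thesis
      unfolding convex_hull_3_alt by (auto simp: L_def add.assoc)
  qed
  then have "integral (convex hull {A, B, C}) f =
      \<bar>det (matrix L)\<bar> * integral ?V (\<lambda>x. f (A + L x))"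
    using integral_affine_image_cart[OF lin inj compact_standard_triangle f] by simp
  also have "integral ?V (\<lambda>x. f (A + L x)) = integral {0..1} (\<lambda>t. integral {0..1-t} (\<lambda>s. f (A + s *\<^sub>R (B - A) + t *\<^sub>R (C - A))))"
    using integral_standard_triangle[of "\<lambda>p. f (A + fst p *\<^sub>R (B - A) + snd p *\<^sub>R (C - A))"]
    by (simp add: L_def continuous_on_compose2[OF f] continuous_intros add.assoc)
  finally show "integral (convex hull {A, B, C}) f = \<bar>det (matrix L)\<bar> *
     integral {0..1} (\<lambda>t. integral {0..1-t} (\<lambda>s. f (A + s *\<^sub>R (B - A) + t *\<^sub>R (C - A))))" .
qed

section \<open>First-order effect of a shift on an interval integral\<close>

text \<open>Shifting the integrand amounts to moving the interval, which changes the integral only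
  by two end pieces of length \<open>\<bar>h\<bar>\<close>. On each piece \<open>k\<close> stays
  within \<open>L * \<bar>h\<bar>\<close> of its value at \<open>0\<close> or \<open>r\<close>,
  which costs an error \<open>L * h^2\<close> per end. The sign of \<open>h\<close> is
  arbitrary.\<close>

lemma integral_shift_lipschitz:
  fixes k :: "real \<Rightarrow> real"
  assumes lip: "\<And>x y. \<bar>k x - k y\<bar> \<le> L * \<bar>x - y\<bar>" and r: "0 \<le> r"
  shows "\<bar>integral {0..r} (\<lambda>s. k (s - h)) - integral {0..r} k - h * (k 0 - k r)\<bar> \<le> 2 * L * h\<^sup>2"
proof -
  have L: "0 \<le> L" using lip[of 0 1] by simp
  have contk: "continuous_on S k" for S
    by (rule lipschitz_on_continuous_on[of L]) (auto simp: lipschitz_on_def dist_real_def L lip)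
  \<comment> \<open>\<open>{-M..M}\<close> contains both \<open>{0..r}\<close> and its translate by
    \<open>-h\<close>, so a single antiderivative \<open>K\<close> serves both integrals.\<close>
  define M where "M = r + \<bar>h\<bar>"
  obtain K where K: "\<And>x. x \<in> {-M..M} \<Longrightarrow> (K has_vector_derivative k x) (at x within {-M..M})"
    using antiderivative_continuous[OF contk] by blast
  have ftc: "integral {a..b} k = K b - K a" if "-M \<le> a" "a \<le> b" "b \<le> M" for a b
    using that K
    by (intro integral_unique fundamental_theorem_of_calculus)
       (auto intro: has_vector_derivative_within_subset[of K _ _ "{-M..M}"])
  \<comment> \<open>Mean value inequality for \<open>K z - z * k x\<close> on the segment from
    \<open>x\<close> to \<open>x - h\<close>: the derivative \<open>k z - k x\<close> is at most
    \<open>L * \<bar>h\<bar>\<close> in size there.\<close>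
  have err: "\<bar>K (x - h) - K x + h * k x\<bar> \<le> L * h\<^sup>2" if "x \<in> {0..r}" for x
  proof -
    let ?S = "closed_segment x (x - h)"
    have S: "?S \<subseteq> {-M..M}"
      using that r unfolding M_def closed_segment_eq_real_ivl by auto
    have "norm ((K (x - h) - (x - h) * k x) - (K x - x * k x)) \<le> (L * \<bar>h\<bar>) * norm ((x - h) - x)"
    proof (rule field_differentiable_bound[of ?S])
      fix z assume z: "z \<in> ?S"
      then have "(K has_field_derivative k z) (at z within ?S)"
        using K S has_real_derivative_iff_has_vector_derivative has_vector_derivative_within_subset by blast
      then show "((\<lambda>z. K z - z * k x) has_field_derivative k z - k x) (at z within ?S)"
        by (auto intro!: derivative_eq_intros)
      have "\<bar>z - x\<bar> \<le> \<bar>h\<bar>" using z by (auto simp: closed_segment_eq_real_ivl split: if_splits)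
      then show "norm (k z - k x) \<le> L * \<bar>h\<bar>"
        using lip[of z x] L by (metis mult_left_mono order_trans real_norm_def)
    qed auto
    then show ?thesis by (simp add: algebra_simps power2_eq_square)
  qed
  have "integral {0..r} (\<lambda>s. k (s - h)) = integral {-h..r-h} k"
    using integral_shift[of 0 "-h" r k] contk by (simp add: o_def)
  also have "\<dots> = K (r - h) - K (- h)"
    using r by (intro ftc) (auto simp: M_def)
  finally have 1: "integral {0..r} (\<lambda>s. k (s - h)) = K (r - h) - K (- h)" .
  have 2: "integral {0..r} k = K r - K 0"
    using r by (intro ftc) (auto simp: M_def)
  have "integral {0..r} (\<lambda>s. k (s - h)) - integral {0..r} k - h * (k 0 - k r)
      = (K (r - h) - K r + h * k r) - (K (0 - h) - K 0 + h * k 0)"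
    unfolding 1 2 by (simp add: algebra_simps)
  also have "\<bar>\<dots>\<bar> \<le> 2 * L * h\<^sup>2"
    using err[of r] err[of 0] r by auto
  finally show ?thesis .
qed

section \<open>Mean distance to a segment\<close>

text \<open>The segment is traversed at constant speed in unit time, so the arc length factor
  cancels against the division by the length of the segment.\<close>

definition mean_dist :: "real^2 \<Rightarrow> real^2 \<Rightarrow> real^2 \<Rightarrow> real" where
  "mean_dist A B X = integral {0..1} (\<lambda>t. norm (linepath A B t - X))"

lemma integrable_norm_linepath:
  "(\<lambda>t. norm (linepath A B t - X)) integrable_on {0..1::real}" for A B X :: "real^2"
  by (intro integrable_continuous_real continuous_intros)

lemma segment_dist_integral_eq:
  assumes "A \<noteq> B"
  shows "segment_dist_integral A B X / norm (B - A) = mean_dist A B X"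
proof -
  have ai: "(\<lambda>t. norm (linepath A B t - X) * norm (B - A)) absolutely_integrable_on {0..1::real}"
    by (intro absolutely_integrable_continuous_real continuous_intros)
  have "segment_dist_integral A B X = (LINT t:{0..1}|lebesgue. norm (linepath A B t - X) * norm (B - A))"
    unfolding segment_dist_integral_def arclength_integral_def
    by (intro set_lebesgue_integral_cong) (auto simp: vector_derivative_linepath_within)
  also have "\<dots> = mean_dist A B X * norm (B - A)"
    unfolding mean_dist_def set_lebesgue_integral_eq_integral(2)[OF ai] by simp
  finally show ?thesis using assms by simp
qed

lemma mean_dist_commute: "mean_dist A B X = mean_dist B A X"
proof -
  have "mean_dist A B X = integral {-1..0} (\<lambda>t. norm (linepath A B (- t) - X))"
    unfolding mean_dist_def using Henstock_Kurzweil_Integration.integral_reflect_real[of 1 0 "\<lambda>t. norm (linepath A B t - X)"] by simp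
  also have "\<dots> = integral {0..1} (\<lambda>t. norm (linepath A B (- (t - 1)) - X))"
    using integral_shift_real_ivl[of "-1" "-1" 0 "\<lambda>t. norm (linepath A B (- t) - X)"] by simp
  finally show ?thesis
    by (simp add: mean_dist_def linepath_def algebra_simps)
qed

text \<open>The integrand is 1-Lipschitz in the base point and the parameter interval has length 1.
  This controls how far the partial derivatives of the distance integral drift when the base point
  moves.\<close>

lemma mean_dist_lipschitz: "\<bar>mean_dist A B X - mean_dist A B Y\<bar> \<le> norm (X - Y)"
proof -
  have "mean_dist A B X - mean_dist A B Y \<le> norm (X - Y)" for X Y
  proof -
    have "mean_dist A B X \<le> integral {0..1} (\<lambda>t::real. norm (linepath A B t - Y) + norm (X - Y))"
      unfolding mean_dist_def
      by (intro integral_le integrable_continuous_real continuous_intros) norm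
    also have "\<dots> = mean_dist A B Y + norm (X - Y)"
      unfolding mean_dist_def by (subst integral_add) (auto intro: integrable_norm_linepath)
    finally show ?thesis by simp
  qed
  from this[of X Y] this[of Y X] show ?thesis by (simp add: norm_minus_commute abs_le_iff)
qed

section \<open>Variation of the distance integral along a side\<close>

lemma compact_triangle: "compact (convex hull {A, B, C})" for A B C :: "real^2"
  by (simp add: finite_imp_compact_convex_hull)

lemma dist_integral_eq_integral:
  assumes "compact T"
  shows "dist_integral T X = integral T (\<lambda>P. norm (P - X))"
  unfolding dist_integral_def
  by (intro set_lebesgue_integral_eq_integral absolutely_integrable_continuous_compact assms continuous_intros)

text \<open>For each fixed \<open>t\<close> the move of \<open>X\<close> is a shift by
  \<open>h\<close> in \<open>s\<close>, so \<open>integral_shift_lipschitz\<close> applies on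
  \<open>{0..1-t}\<close>; integrating over \<open>t\<close> turns the end values into mean
  distances. \<open>D\<close> and \<open>K\<close> do not depend on \<open>X\<close> or
  \<open>h\<close>, so the estimate can be reused at a moved base point.\<close>

lemma dist_integral_triangle_side:
  assumes nc: "\<not> collinear {A, B, C}"
  obtains D K where "D > 0"
    "\<And>X h. \<bar>dist_integral (convex hull {A, B, C}) (X + h *\<^sub>R (B - A)) - dist_integral (convex hull {A, B, C}) X
        - h * (D * (mean_dist A C X - mean_dist B C X))\<bar> \<le> K * h\<^sup>2"
proof -
  let ?T = "convex hull {A, B, C}"
  obtain D where D: "D > 0"
    and eq: "\<And>f :: real^2 \<Rightarrow> real. continuous_on UNIV f \<Longrightarrow> integral ?T f =
      D * integral {0..1} (\<lambda>t. integral {0..1-t} (\<lambda>s. f (A + s *\<^sub>R (B - A) + t *\<^sub>R (C - A))))"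
    using integral_triangle[OF nc] by blast
  define k where "k = (\<lambda>X t s. norm (A + s *\<^sub>R (B - A) + t *\<^sub>R (C - A) - X))"
  have F: "dist_integral ?T X = D * integral {0..1} (\<lambda>t. integral {0..1-t} (k X t))" for X
    unfolding dist_integral_eq_integral[OF compact_triangle] k_def
    by (intro eq continuous_intros)
  have intk: "(\<lambda>t. integral {0..1-t} (k X t)) integrable_on {0..1}" for X
    using integrable_standard_triangle[of "\<lambda>p. norm (A + fst p *\<^sub>R (B - A) + snd p *\<^sub>R (C - A) - X)"]
    unfolding k_def by (simp add: continuous_intros)
  have shift: "k (X + h *\<^sub>R (B - A)) t s = k X t (s - h)" for X h t s
    unfolding k_def by (simp add: algebra_simps)
  \<comment> \<open>The ends \<open>s = 0\<close> and \<open>s = 1 - t\<close> of the inner interval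
    run through the sides \<open>AC\<close> and \<open>BC\<close> with the same parameter
    \<open>t\<close>.\<close>
  have side0: "k X t 0 = norm (linepath A C t - X)" for X t
    unfolding k_def linepath_def by (simp add: algebra_simps)
  have side1: "k X t (1 - t) = norm (linepath B C t - X)" for X t
    unfolding k_def linepath_def by (simp add: algebra_simps)
  have lip: "\<bar>k X t x - k X t y\<bar> \<le> norm (B - A) * \<bar>x - y\<bar>" for X t x y
  proof -
    have "\<bar>k X t x - k X t y\<bar> \<le> norm ((A + x *\<^sub>R (B - A) + t *\<^sub>R (C - A) - X) - (A + y *\<^sub>R (B - A) + t *\<^sub>R (C - A) - X))"
      unfolding k_def by (rule norm_triangle_ineq3)
    also have "\<dots> = norm ((x - y) *\<^sub>R (B - A))"
      by (simp add: algebra_simps)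
    finally show ?thesis by (simp add: mult.commute)
  qed
  show ?thesis
  proof
    show "D > 0" by fact
    fix X h
    let ?X = "X + h *\<^sub>R (B - A)"
    \<comment> \<open>\<open>\<phi> t\<close> is the first-order error on the slice at
      \<open>t\<close>, and \<open>R\<close> is its integral. The Lipschitz constant
      \<open>norm (B - A)\<close> is the same for all slices, so one bound on \<open>\<phi>\<close>
      also bounds \<open>R\<close>.\<close>
    define \<phi> where "\<phi> = (\<lambda>t. integral {0..1-t} (k ?X t) - integral {0..1-t} (k X t)
                      - h * (norm (linepath A C t - X) - norm (linepath B C t - X)))"
    define R where "R = integral {0..1} (\<lambda>t. integral {0..1-t} (k ?X t))
        - integral {0..1} (\<lambda>t. integral {0..1-t} (k X t))
        - h * (mean_dist A C X - mean_dist B C X)"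
    have hi: "(\<phi> has_integral R) {0..1}"
      unfolding \<phi>_def R_def mean_dist_def
      by (intro has_integral_diff has_integral_mult_right integrable_integral intk integrable_norm_linepath)
    have "norm (\<phi> t) \<le> 2 * norm (B - A) * h\<^sup>2" if "t \<in> {0..1}" for t
      using integral_shift_lipschitz[of "k X t" "norm (B - A)" "1 - t" h, OF lip] that
      unfolding \<phi>_def shift side0 side1 by simp
    then have "norm R \<le> 2 * norm (B - A) * h\<^sup>2"
      using has_integral_bound_real[OF _ _ hi, of "2 * norm (B - A) * h\<^sup>2" "{}"] by simp
    then have bound: "\<bar>R\<bar> \<le> 2 * norm (B - A) * h\<^sup>2" by simp
    have "dist_integral ?T ?X - dist_integral ?T X - h * (D * (mean_dist A C X - mean_dist B C X)) = D * R"
      unfolding F R_def by (simp add: right_diff_distrib mult.left_commute)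
    then have "\<bar>dist_integral ?T ?X - dist_integral ?T X - h * (D * (mean_dist A C X - mean_dist B C X))\<bar> = D * \<bar>R\<bar>"
      using D by (simp add: abs_mult)
    also have "\<dots> \<le> D * (2 * norm (B - A) * h\<^sup>2)"
      using D bound by (intro mult_left_mono) auto
    finally show "\<bar>dist_integral ?T ?X - dist_integral ?T X - h * (D * (mean_dist A C X - mean_dist B C X))\<bar>
       \<le> D * (2 * norm (B - A)) * h\<^sup>2" by (simp add: mult.assoc)
  qed
qed

section \<open>Critical points and minimisers\<close>

text \<open>This stands for letting \<open>h\<close> tend to 0 after a quadratic bound has been
  divided by \<open>h\<close>.\<close>

lemma nonpos_if_le_small_multiples:
  fixes d M :: real
  assumes "\<And>h. \<lbrakk>0 < h; h \<le> 1\<rbrakk> \<Longrightarrow> d \<le> M * h"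
  shows "d \<le> 0"
proof (rule ccontr)
  assume "\<not> d \<le> 0"
  then have d: "d > 0" by simp
  with assms[of 1] have M: "M > 0" by simp
  \<comment> \<open>With this \<open>h\<close> the assumed bound gives \<open>d \<le> d / 2\<close>,
    impossible for positive \<open>d\<close>.\<close>
  define h where "h = min 1 (d / (2 * M))"
  have "0 < h" "h \<le> 1" "h \<le> d / (2 * M)" using d M by (auto simp: h_def)
  then have "d \<le> M * (d / (2 * M))"
    using assms[of h] M by (meson mult_left_mono less_imp_le order_trans)
  then show False using d M by simp
qed

lemma mean_dist_eq_if_dist_integral_minimal:
  assumes nc: "\<not> collinear {A, B, C}"
    and min: "\<And>Y. dist_integral (convex hull {A, B, C}) X \<le> dist_integral (convex hull {A, B, C}) Y"
  shows "mean_dist A C X = mean_dist B C X"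
proof -
  obtain D K where D: "D > 0" and
    est: "\<And>X h. \<bar>dist_integral (convex hull {A, B, C}) (X + h *\<^sub>R (B - A)) - dist_integral (convex hull {A, B, C}) X
        - h * (D * (mean_dist A C X - mean_dist B C X))\<bar> \<le> K * h\<^sup>2"
    using dist_integral_triangle_side[OF nc] by blast
  \<comment> \<open>\<open>G\<close> is the derivative at \<open>X\<close> in direction
    \<open>B - A\<close>. Minimality against steps \<open>h\<close> and \<open>-h\<close> bounds
    \<open>G\<close> from below and above by \<open>K * h\<close> in size.\<close>
  define G where "G = D * (mean_dist A C X - mean_dist B C X)"
  have "\<bar>G\<bar> \<le> 0"
  proof (rule nonpos_if_le_small_multiples)
    fix h :: real assume h: "0 < h" "h \<le> 1"
    have "- (h * G) \<le> K * h\<^sup>2"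
      using est[of X h] min[of "X + h *\<^sub>R (B - A)"] unfolding G_def by linarith
    moreover have "h * G \<le> K * h\<^sup>2"
      using est[of X "- h"] min[of "X + (- h) *\<^sub>R (B - A)"] unfolding G_def by simp
    ultimately have "h * \<bar>G\<bar> \<le> h * (K * h)" by (simp add: abs_if power2_eq_square mult_ac)
    then show "\<bar>G\<bar> \<le> K * h" using h by simp
  qed
  then show ?thesis using D by (simp add: G_def)
qed

text \<open>The direction \<open>v\<close> is split along the two edge vectors at \<open>A\<close>,
  and the step is made in two legs. The second leg starts at a point \<open>Y\<close> where the mean
  distances may no longer agree, but their gap is of order \<open>h\<close> and is multiplied by a
  step of order \<open>h\<close>.\<close>

lemma dist_integral_critical:
  assumes nc: "\<not> collinear {A, B, C}"
    and eq: "mean_dist A B X = mean_dist B C X" "mean_dist A C X = mean_dist B C X"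
  obtains M where
    "\<And>h. \<bar>dist_integral (convex hull {A, B, C}) (X + h *\<^sub>R v) - dist_integral (convex hull {A, B, C}) X\<bar> \<le> M * h\<^sup>2"
proof -
  let ?F = "dist_integral (convex hull {A, B, C})"
  obtain D K where D: "D > 0" and
    est: "\<And>X h. \<bar>?F (X + h *\<^sub>R (B - A)) - ?F X - h * (D * (mean_dist A C X - mean_dist B C X))\<bar> \<le> K * h\<^sup>2"
    using dist_integral_triangle_side[OF nc] by blast
  \<comment> \<open>Exchanging the roles of \<open>B\<close> and \<open>C\<close> yields the
    estimate in direction \<open>C - A\<close> for the same triangle.\<close>
  have nc': "\<not> collinear {A, C, B}" using nc by (simp add: insert_commute)
  obtain D' K' where D': "D' > 0" and
    "\<And>X h. \<bar>dist_integral (convex hull {A, C, B}) (X + h *\<^sub>R (C - A)) - dist_integral (convex hull {A, C, B}) X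
         - h * (D' * (mean_dist A B X - mean_dist C B X))\<bar> \<le> K' * h\<^sup>2"
    using dist_integral_triangle_side[OF nc'] by blast
  then have est': "\<bar>?F (X + h *\<^sub>R (C - A)) - ?F X - h * (D' * (mean_dist A B X - mean_dist C B X))\<bar> \<le> K' * h\<^sup>2" for X h
    by (simp add: insert_commute)
  have "surj (\<lambda>x::real^2. x $ 1 *\<^sub>R (B - A) + x $ 2 *\<^sub>R (C - A))"
    by (intro linear_inj_imp_surj linear_triangle_coordinates inj_triangle_coordinates nc)
  then obtain x :: "real^2" where v: "v = x $ 1 *\<^sub>R (B - A) + x $ 2 *\<^sub>R (C - A)"
    unfolding surj_def by blast
  define p q where "p = x $ 1" and "q = x $ 2"
  \<comment> \<open>The first two terms are the errors of the two legs; the third comes from the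
    drift of the derivative between \<open>X\<close> and \<open>Y\<close>.\<close>
  let ?M = "K * p\<^sup>2 + K' * q\<^sup>2 + \<bar>q\<bar> * D' * (2 * (\<bar>p\<bar> * norm (B - A)))"
  show ?thesis
  proof
    fix h :: real
    define Y where "Y = X + (h * p) *\<^sub>R (B - A)"
    have 1: "\<bar>?F Y - ?F X\<bar> \<le> K * (h * p)\<^sup>2"
      using est[of X "h * p"] eq unfolding Y_def by simp
    \<comment> \<open>Both mean distances agree at \<open>X\<close> and each is 1-Lipschitz, hence
      the factor 2.\<close>
    have "\<bar>mean_dist A B Y - mean_dist C B Y\<bar> \<le> 2 * norm (X - Y)"
      using mean_dist_lipschitz[of A B X Y] mean_dist_lipschitz[of B C X Y] eq
      unfolding mean_dist_commute[of C B] by linarith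
    also have "norm (X - Y) = \<bar>h\<bar> * (\<bar>p\<bar> * norm (B - A))"
      unfolding Y_def by (simp add: abs_mult)
    finally have "\<bar>(h * q) * (D' * (mean_dist A B Y - mean_dist C B Y))\<bar> \<le> \<bar>h * q\<bar> * (D' * (2 * (\<bar>h\<bar> * (\<bar>p\<bar> * norm (B - A)))))"
      using D' unfolding abs_mult[of "h * q"] abs_mult[of D'] by (intro mult_left_mono) auto
    also have "\<dots> = \<bar>q\<bar> * D' * (2 * (\<bar>p\<bar> * norm (B - A))) * h\<^sup>2"
      by (simp add: abs_mult power2_eq_square mult_ac)
    finally have "\<bar>?F (Y + (h * q) *\<^sub>R (C - A)) - ?F Y\<bar> \<le> K' * (h * q)\<^sup>2 + \<bar>q\<bar> * D' * (2 * (\<bar>p\<bar> * norm (B - A))) * h\<^sup>2"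
      using est'[of Y "h * q"] by linarith
    with 1 have "\<bar>?F (Y + (h * q) *\<^sub>R (C - A)) - ?F X\<bar> \<le> K * (h * p)\<^sup>2 + K' * (h * q)\<^sup>2 + \<bar>q\<bar> * D' * (2 * (\<bar>p\<bar> * norm (B - A))) * h\<^sup>2"
      by linarith
    moreover have "Y + (h * q) *\<^sub>R (C - A) = X + h *\<^sub>R v"
      unfolding Y_def v p_def q_def by (simp add: scaleR_add_right add.assoc)
    ultimately show "\<bar>?F (X + h *\<^sub>R v) - ?F X\<bar> \<le> ?M * h\<^sup>2"
      by (simp add: algebra_simps power_mult_distrib)
  qed
qed

text \<open>The distance to a fixed \<open>P\<close> is convex by the triangle inequality, and
  integration over \<open>P\<close> preserves this.\<close>

lemma dist_integral_convex:
  assumes T: "compact T" and h: "0 \<le> h" "h \<le> 1"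
  shows "dist_integral T (X + h *\<^sub>R (Y - X)) \<le> dist_integral T X + h * (dist_integral T Y - dist_integral T X)"
proof -
  have int: "(\<lambda>P. norm (P - X)) integrable_on T" for X
    by (intro set_lebesgue_integral_eq_integral absolutely_integrable_continuous_compact T continuous_intros)
  have "integral T (\<lambda>P. norm (P - (X + h *\<^sub>R (Y - X)))) \<le> integral T (\<lambda>P. (1 - h) * norm (P - X) + h * norm (P - Y))"
  proof (intro integral_le int integrable_add integrable_on_mult_right)
    fix P
    have "P - (X + h *\<^sub>R (Y - X)) = (1 - h) *\<^sub>R (P - X) + h *\<^sub>R (P - Y)"
      by (simp add: algebra_simps)
    then show "norm (P - (X + h *\<^sub>R (Y - X))) \<le> (1 - h) * norm (P - X) + h * norm (P - Y)"
      using h norm_triangle_ineq[of "(1 - h) *\<^sub>R (P - X)" "h *\<^sub>R (P - Y)"] by simp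
  qed
  also have "\<dots> = (1 - h) * integral T (\<lambda>P. norm (P - X)) + h * integral T (\<lambda>P. norm (P - Y))"
    by (subst integral_add) (auto intro: int integrable_on_mult_right)
  finally show ?thesis
    unfolding dist_integral_eq_integral[OF T] by (simp add: algebra_simps)
qed

text \<open>Along the segment to \<open>Y\<close>, convexity forces a decrease of at least
  \<open>h * (?F X - ?F Y)\<close>, whereas criticality allows a change of order \<open>h^2\<close>
  only.\<close>

lemma dist_integral_minimal_if_mean_dist_eq:
  assumes nc: "\<not> collinear {A, B, C}"
    and eq: "mean_dist A B X = mean_dist B C X" "mean_dist A C X = mean_dist B C X"
  shows "dist_integral (convex hull {A, B, C}) X \<le> dist_integral (convex hull {A, B, C}) Y"
proof -
  let ?F = "dist_integral (convex hull {A, B, C})"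
  obtain M where M: "\<And>h. \<bar>?F (X + h *\<^sub>R (Y - X)) - ?F X\<bar> \<le> M * h\<^sup>2"
    using dist_integral_critical[OF nc eq] by blast
  have "?F X - ?F Y \<le> 0"
  proof (rule nonpos_if_le_small_multiples)
    fix h :: real assume h: "0 < h" "h \<le> 1"
    have "h * (?F X - ?F Y) \<le> h * (M * h)"
      using M[of h] dist_integral_convex[OF compact_triangle, of h A B C X Y] h
      by (simp add: algebra_simps power2_eq_square)
    then show "?F X - ?F Y \<le> M * h" using h by simp
  qed
  then show ?thesis by simp
qed

section \<open>Uniqueness of the minimiser\<close>

text \<open>Around each interior point there is a closed box inside \<open>T\<close>, on which the
  nonnegative continuous \<open>f\<close> has integral 0 and so vanishes. A closed convex set with
  nonempty interior is the closure of that interior, so continuity extends this to all of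
  \<open>T\<close>.\<close>

lemma integral_eq_0_imp_0_on_compact_convex:
  fixes f :: "'a::euclidean_space \<Rightarrow> real"
  assumes T: "compact T" "convex T" "interior T \<noteq> {}"
    and f: "continuous_on T f" "\<And>x. x \<in> T \<Longrightarrow> 0 \<le> f x"
    and int: "integral T f \<le> 0" and x: "x \<in> T"
  shows "f x = 0"
proof -
  have intT: "f integrable_on T"
    by (rule set_lebesgue_integral_eq_integral(1)[OF absolutely_integrable_continuous_compact[OF f(1) T(1)]])
  have "f y = 0" if y: "y \<in> interior T" for y
  proof -
    obtain a b where ab: "y \<in> box a b" "cbox a b \<subseteq> interior T"
      using open_contains_cbox[OF open_interior y] by metis
    then have sub: "cbox a b \<subseteq> T" using interior_subset by blast
    have intab: "f integrable_on cbox a b"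
      using f(1) sub by (intro integrable_continuous) (rule continuous_on_subset)
    have "integral (cbox a b) f \<le> integral T f"
      using f sub intab intT by (intro integral_subset_le) auto
    moreover have "0 \<le> integral (cbox a b) f"
      using f sub intab by (intro integral_nonneg) auto
    ultimately have "integral (cbox a b) f = 0" using int by simp
    then have "(f has_integral 0) (cbox a b)" using intab by (metis integrable_integral)
    then show ?thesis
      using ab(1) f sub box_subset_cbox[of a b]
      by (intro has_integral_0_cbox_imp_0[of a b f]) (auto intro: continuous_on_subset)
  qed
  moreover have "closure (interior T) = T"
    using T by (simp add: convex_closure_interior compact_imp_closed closure_closed)
  ultimately show ?thesis
    using continuous_constant_on_closure[of "interior T" f 0 x] f(1) x by simp
qed

text \<open>For two distinct minimisers, comparison with their midpoint forces equality in the
  triangle inequality at every point of the triangle. The whole triangle then lies on the line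
  through \<open>X\<close> and \<open>Y\<close>, contrary to non-collinearity.\<close>

lemma dist_integral_minimiser_unique:
  assumes nc: "\<not> collinear {A, B, C}"
    and X: "\<And>Z. dist_integral (convex hull {A, B, C}) X \<le> dist_integral (convex hull {A, B, C}) Z"
    and Y: "\<And>Z. dist_integral (convex hull {A, B, C}) Y \<le> dist_integral (convex hull {A, B, C}) Z"
  shows "X = Y"
proof (rule ccontr)
  assume "X \<noteq> Y"
  let ?T = "convex hull {A, B, C}"
  let ?f = "\<lambda>P. norm (P - X) + norm (P - Y) - 2 * norm (P - midpoint X Y)"
  have int: "(\<lambda>P. norm (P - X)) integrable_on ?T" for X
    by (intro set_lebesgue_integral_eq_integral absolutely_integrable_continuous_compact
        compact_triangle continuous_intros)
  have two: "2 * norm (P - midpoint X Y) = norm ((P - X) + (P - Y))" for P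
  proof -
    have "(P - X) + (P - Y) = 2 *\<^sub>R (P - midpoint X Y)"
      by (simp add: midpoint_def algebra_simps scaleR_2)
    then show ?thesis by simp
  qed
  have "((\<lambda>P. norm (P - X) + norm (P - Y) - 2 * norm (P - midpoint X Y)) has_integral
     dist_integral ?T X + dist_integral ?T Y - 2 * dist_integral ?T (midpoint X Y)) ?T"
    unfolding dist_integral_eq_integral[OF compact_triangle]
    by (intro has_integral_diff has_integral_add has_integral_mult_right integrable_integral int)
  \<comment> \<open>Both minimal values are at most the value at the midpoint.\<close>
  then have le: "integral ?T ?f \<le> 0"
    using X[of "midpoint X Y"] Y[of "midpoint X Y"] by (simp add: integral_unique)
  have "interior ?T \<noteq> {}"
  proof -
    have dim2: "DIM(real^2) = 2" by simp
    \<comment> \<open>The centroid is interior because all its barycentric coordinates are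
      positive.\<close>
    have "(1/3) *\<^sub>R A + (1/3) *\<^sub>R B + (1/3) *\<^sub>R C \<in> interior ?T"
      unfolding interior_convex_hull_3_minimal[OF nc dim2]
      by (rule CollectI, (rule exI[of _ "1/3::real"])+) simp
    then show ?thesis by blast
  qed
  moreover have "0 \<le> ?f P" for P
    using norm_triangle_ineq[of "P - X" "P - Y"] unfolding two by simp
  moreover have "continuous_on ?T ?f"
    by (intro continuous_intros)
  ultimately have zero: "?f P = 0" if "P \<in> ?T" for P
    using integral_eq_0_imp_0_on_compact_convex[of ?T ?f P] that le
    by (simp add: compact_triangle)
  have line: "P \<in> affine hull {X, Y}" if "P \<in> ?T" for P
  proof -
    have "norm ((P - X) + (P - Y)) = norm (P - X) + norm (P - Y)"
      using zero[OF that] two[of P] by simp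
    then have "norm (P - X) *\<^sub>R (P - Y) = norm (P - Y) *\<^sub>R (P - X)"
      using norm_triangle_eq by blast
    then have eq: "norm (P - X) *\<^sub>R (Y - P) = norm (P - Y) *\<^sub>R (X - P)"
      by (simp add: algebra_simps)
    \<comment> \<open>This is the disjunction that \<open>collinear_lemma\<close> asks for; the case
      \<open>X = P\<close> is separate because of the division by
      \<open>norm (P - X)\<close>.\<close>
    have "X - P = 0 \<or> Y - P = (norm (P - Y) / norm (P - X)) *\<^sub>R (X - P)"
    proof (cases "X = P")
      case False
      then have "Y - P = (1 / norm (P - X)) *\<^sub>R (norm (P - X) *\<^sub>R (Y - P))" by simp
      then show ?thesis unfolding eq by simp
    qed simp
    then have "collinear {0, X - P, Y - P}"
      unfolding collinear_lemma by blast
    then have "collinear {X, P, Y}"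
      by (subst collinear_3) (simp add: NO_MATCH_def)
    then show ?thesis
      using \<open>X \<noteq> Y\<close> collinear_3_affine_hull[of X Y P] by (simp add: insert_commute)
  qed
  have "{A, B, C} \<subseteq> affine hull {X, Y}"
    using line hull_subset[of "{A, B, C}" convex] by blast
  then show False using nc collinear_affine_hull by blast
qed

theorem mainTheorem2:
  fixes P1 P2 P3 m :: "real^2"
  assumes "\<not> collinear {P1, P2, P3}"
  shows "is_geometric_median (convex hull {P1, P2, P3}) m \<longleftrightarrow>
    segment_dist_integral P1 P2 m / norm (P2 - P1) = segment_dist_integral P2 P3 m / norm (P3 - P2) \<and>
    segment_dist_integral P2 P3 m / norm (P3 - P2) = segment_dist_integral P3 P1 m / norm (P1 - P3)"
proof -
  let ?F = "dist_integral (convex hull {P1, P2, P3})"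
  have ne: "P1 \<noteq> P2" "P2 \<noteq> P3" "P3 \<noteq> P1"
    using assms by (auto simp: insert_commute)
  \<comment> \<open>The two vertex orders \<open>P1, P2, P3\<close> and \<open>P1, P3, P2\<close>
    supply the critical point conditions in the directions \<open>P2 - P1\<close> and
    \<open>P3 - P1\<close>.\<close>
  have nc: "\<not> collinear {P1, P3, P2}" using assms by (simp add: insert_commute)
  have min_iff: "is_arg_min ?F (\<lambda>_. True) X \<longleftrightarrow> (\<forall>Y. ?F X \<le> ?F Y)" for X
    by (simp add: is_arg_min_linorder)
  \<comment> \<open>Since two minimisers coincide, a point that minimises is the only one, so the
    set of minimisers is the singleton required by the definition.\<close>
  have "is_geometric_median (convex hull {P1, P2, P3}) m \<longleftrightarrow> (\<forall>Y. ?F m \<le> ?F Y)"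
    unfolding is_geometric_median_def min_iff
    using dist_integral_minimiser_unique[OF assms] by blast
  also have "\<dots> \<longleftrightarrow> mean_dist P1 P2 m = mean_dist P2 P3 m \<and> mean_dist P2 P3 m = mean_dist P3 P1 m"
  proof
    assume min: "\<forall>Y. ?F m \<le> ?F Y"
    then have "mean_dist P1 P3 m = mean_dist P2 P3 m"
      using mean_dist_eq_if_dist_integral_minimal[OF assms] by blast
    moreover have "mean_dist P1 P2 m = mean_dist P3 P2 m"
      using min mean_dist_eq_if_dist_integral_minimal[OF nc, of m] by (simp add: insert_commute)
    ultimately show "mean_dist P1 P2 m = mean_dist P2 P3 m \<and> mean_dist P2 P3 m = mean_dist P3 P1 m"
      by (simp add: mean_dist_commute)
  next
    assume "mean_dist P1 P2 m = mean_dist P2 P3 m \<and> mean_dist P2 P3 m = mean_dist P3 P1 m"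
    then show "\<forall>Y. ?F m \<le> ?F Y"
      using dist_integral_minimal_if_mean_dist_eq[OF assms, of m] mean_dist_commute[of P1 P3 m] by simp
  qed
  finally show ?thesis
    using ne by (simp add: segment_dist_integral_eq)
qed

end
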